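(* For $a\in\mathbb{Q}$, $a>0$, let $\mathcal{R}_a$ be the rectangle with vertices $(0,0)$, $(0,1)$, $(a,0)$, $(a,1)$. Then the set of positive $a\in\mathbb{Q}$ for which there are infinitely many points $(x,y)\in\mathbb{Q}^2$ with $0<x<a$ and $0<y<1$ whose distances to each of the four vertices of $\mathcal{R}_a$ are rational is dense in $\mathbb{R}_{+}=(0,\infty)$.
   Context: No further context is needed. *)

theory Defs
  imports "HOL-Analysis.Analysis"
begin

definition pdist :: "real \<times> real \<Rightarrow> real \<times> real \<Rightarrow> real" where
  "pdist p q = sqrt ((fst p - fst q)^2 + (snd p - snd q)^2)"

definition good_points :: "real \<Rightarrow> (real \<times> real) set" where
  "good_points a = {(x, y). x \<in> \<rat> \<and> y \<in> \<rat> \<and> 0 < x \<and> x < a \<and> 0 < y \<and> y < 1 \<and>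
     pdist (x, y) (0, 0) \<in> \<rat> \<and> pdist (x, y) (0, 1) \<in> \<rat> \<and>
     pdist (x, y) (a, 0) \<in> \<rat> \<and> pdist (x, y) (a, 1) \<in> \<rat>}"

definition good_sides :: "real set" where
  "good_sides = {a. a \<in> \<rat> \<and> 0 < a \<and> infinite (good_points a)}"

end

theory Submission
  imports Defs
begin

text \<open>
  Restrict to the midline y = 1/2 and put w = 4x - 2a. The distances are rational iff
  (w + 2a)^2 + 4 and (w - 2a)^2 + 4 are squares X^2 and Y^2; these equations define an elliptic
  curve with an explicit doubling map (a form of the duplication formula of the function sn).
  Points inside the rectangle are those with |w| < 2a.

  A point whose three coordinates have the same sufficiently negative 2-adic valuation has an
  infinite orbit under doubling, since each doubling lowers the valuation by one. If a is at least
  4/5, doubling shrinks |w| by a fixed factor whenever both the point and its double lie outside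
  the rectangle, so the orbit returns to the interior infinitely often. Starting points of the
  required kind exist for a = r(16r - 17)/(16r - 1) with r any rational of odd denominator; these
  values accumulate at every c \<ge> 1, and the similarity of the a by 1 and 1 by 1/a rectangles
  covers c < 1.
\<close>

section \<open>Arithmetic in the localization of the integers at 2\<close>

definition int2 :: "real set" where
  "int2 = {of_int m / of_int n | m n. odd n}"

text \<open>The units of \<open>int2\<close>, that is, the rationals of 2-adic valuation 0.\<close>

definition unit2 :: "real set" where
  "unit2 = {of_int m / of_int n | m n. odd m \<and> odd n}"

lemma int2I: "odd n \<Longrightarrow> of_int m / of_int n \<in> int2"
  unfolding int2_def by blast

lemma unit2I: "odd m \<Longrightarrow> odd n \<Longrightarrow> of_int m / of_int n \<in> unit2"
  unfolding unit2_def by blast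

lemma int2_of_int: "of_int m \<in> int2"
  using int2I[of 1 m] by simp

lemma int2_numeral: "numeral m \<in> int2"
  using int2_of_int[of "numeral m"] by simp

lemma unit2_int2: "x \<in> unit2 \<Longrightarrow> x \<in> int2"
  unfolding unit2_def int2_def by blast

lemma int2_Rats: "x \<in> int2 \<Longrightarrow> x \<in> \<rat>"
  unfolding int2_def by auto

lemma unit2_nonzero: "x \<in> unit2 \<Longrightarrow> x \<noteq> 0"
  unfolding unit2_def by auto

lemma odd_of_int_nonzero: "odd (n :: int) \<Longrightarrow> (of_int n :: real) \<noteq> 0"
  by auto

lemma int2_add:
  assumes "x \<in> int2" "y \<in> int2" shows "x + y \<in> int2"
proof -
  obtain m n p q where h: "x = of_int m / of_int n" "y = of_int p / of_int q" "odd n" "odd q"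
    using assms unfolding int2_def by blast
  have "x + y = of_int (m * q + p * n) / of_int (n * q)"
    using h odd_of_int_nonzero[of n] odd_of_int_nonzero[of q] by (simp add: field_simps)
  then show ?thesis using int2I[of "n * q"] h by (metis even_mult_iff)
qed

lemma int2_mult:
  assumes "x \<in> int2" "y \<in> int2" shows "x * y \<in> int2"
proof -
  obtain m n p q where h: "x = of_int m / of_int n" "y = of_int p / of_int q" "odd n" "odd q"
    using assms unfolding int2_def by blast
  have "x * y = of_int (m * p) / of_int (n * q)" using h by simp
  then show ?thesis using int2I[of "n * q"] h by (metis even_mult_iff)
qed

lemma int2_diff: "x \<in> int2 \<Longrightarrow> y \<in> int2 \<Longrightarrow> x - y \<in> int2"
  using int2_add[of x "of_int (-1) * y"] int2_mult[OF int2_of_int[of "-1"]] by simp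

lemma int2_power: "x \<in> int2 \<Longrightarrow> x ^ n \<in> int2"
  using int2_of_int[of 1] by (induction n) (auto intro: int2_mult)

lemma unit2_divide:
  assumes "x \<in> unit2" "y \<in> unit2" shows "x / y \<in> unit2"
proof -
  obtain m n p q where h: "x = of_int m / of_int n" "y = of_int p / of_int q"
      "odd m" "odd n" "odd p" "odd q"
    using assms unfolding unit2_def by blast
  have "x / y = of_int (m * q) / of_int (n * p)" using h by simp
  then show ?thesis using unit2I[of "m * q" "n * p"] h by (metis even_mult_iff)
qed

lemma unit2_one: "1 \<in> unit2"
  using unit2I[of 1 1] by simp

lemma unit2_mult: "x \<in> unit2 \<Longrightarrow> y \<in> unit2 \<Longrightarrow> x * y \<in> unit2"
  using unit2_divide[of x "1 / y"] unit2_divide[OF unit2_one, of y] by simp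

lemma unit2_power: "x \<in> unit2 \<Longrightarrow> x ^ n \<in> unit2"
  using unit2_one by (induction n) (auto intro: unit2_mult)

text \<open>The residue field has two elements, so a unit is exactly an element congruent to 1
  modulo 2. Every valuation computation below is brought to this form.\<close>

lemma unit2_add_even:
  assumes "x \<in> unit2" "y \<in> int2" shows "x + 2 * y \<in> unit2"
proof -
  obtain m n p q where h: "x = of_int m / of_int n" "y = of_int p / of_int q"
      "odd m" "odd n" "odd q"
    using assms unfolding unit2_def int2_def by blast
  have "x + 2 * y = of_int (m * q + 2 * p * n) / of_int (n * q)"
    unfolding h(1,2) using h(4,5) odd_of_int_nonzero[of n] odd_of_int_nonzero[of q] by (simp add: field_simps)
  moreover have "odd (m * q + 2 * p * n)" "odd (n * q)" using h by simp_all
  ultimately show ?thesis using unit2I by metis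
qed

lemma even_not_unit2:
  assumes "y \<in> int2" shows "2 * y \<notin> unit2"
proof
  assume "2 * y \<in> unit2"
  then obtain m n p q where h: "2 * y = of_int m / of_int n" "y = of_int p / of_int q"
      "odd m" "odd n" "odd q"
    using assms unfolding unit2_def int2_def by blast
  have "of_int (2 * p * n) = (of_int (m * q) :: real)"
    using h odd_of_int_nonzero[of n] odd_of_int_nonzero[of q] by (simp add: field_simps)
  then have "2 * p * n = m * q" by linarith
  then show False using h by (metis even_mult_iff dvd_triv_left)
qed

text \<open>The exponent is minus the 2-adic valuation of \<open>x\<close>. This is what later
  separates the points of a doubling orbit.\<close>

lemma two_adic_scale_unique:
  assumes "2 ^ m * x \<in> unit2" "2 ^ n * x \<in> unit2" shows "m = n"
proof -
  have False if "i < j" "2 ^ i * x \<in> unit2" "2 ^ j * x \<in> unit2" for i j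
  proof -
    obtain k where k: "j = Suc (i + k)" using less_imp_Suc_add[OF \<open>i < j\<close>] by blast
    have "2 ^ j * x = 2 * (2 ^ k * (2 ^ i * x))" by (simp add: k power_add)
    moreover have "2 ^ k * (2 ^ i * x) \<in> int2"
      using that(2) by (intro int2_mult int2_power int2_numeral unit2_int2)
    ultimately show False using even_not_unit2 that(3) by metis
  qed
  then show ?thesis using assms by (metis linorder_neqE_nat)
qed

section \<open>The curve, its doubling map and 2-adic valuations\<close>

text \<open>Here w = 4x - 2a, X = 4 |(x, 1/2) - (0, 0)| and Y = 4 |(x, 1/2) - (a, 0)| up to sign.\<close>

definition on_curve :: "real \<Rightarrow> real \<Rightarrow> real \<Rightarrow> real \<Rightarrow> bool" where
  "on_curve a w X Y \<longleftrightarrow> X\<^sup>2 = (w + 2 * a)\<^sup>2 + 4 \<and> Y\<^sup>2 = (w - 2 * a)\<^sup>2 + 4"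

text \<open>The two squares are \<open>w^2 + K + 4*a*w\<close> and \<open>w^2 + K - 4*a*w\<close>,
  so their product is a difference of squares. The second form, a sum of squares, bounds the
  denominator of the doubled point from below.\<close>

lemma on_curve_prod:
  assumes "on_curve a w X Y" "K = 4 * a\<^sup>2 + 4"
  shows "(X * Y)\<^sup>2 = (w\<^sup>2 + K)\<^sup>2 - 16 * a\<^sup>2 * w\<^sup>2" "(X * Y)\<^sup>2 = (w\<^sup>2 - K)\<^sup>2 + 16 * w\<^sup>2"
proof -
  have "(X * Y)\<^sup>2 = ((w + 2 * a)\<^sup>2 + 4) * ((w - 2 * a)\<^sup>2 + 4)"
    using assms(1) unfolding on_curve_def by (simp add: power_mult_distrib)
  then show "(X * Y)\<^sup>2 = (w\<^sup>2 + K)\<^sup>2 - 16 * a\<^sup>2 * w\<^sup>2"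
    "(X * Y)\<^sup>2 = (w\<^sup>2 - K)\<^sup>2 + 16 * w\<^sup>2"
    unfolding assms(2) by algebra+
qed

lemma on_curve_double:
  assumes c: "on_curve a w X Y" and nz: "w \<noteq> 0" "X \<noteq> 0" "Y \<noteq> 0" and K: "K = 4 * a\<^sup>2 + 4"
  shows "on_curve a ((w ^ 4 - K\<^sup>2) / (2 * w * (X * Y)))
    (((w\<^sup>2 + K) * (X * Y) + 4 * a * w * (w\<^sup>2 - K)) / (2 * w * (X * Y)))
    (((w\<^sup>2 + K) * (X * Y) - 4 * a * w * (w\<^sup>2 - K)) / (2 * w * (X * Y)))"
proof -
  define P where "P = X * Y"
  have P: "P\<^sup>2 = (w\<^sup>2 + K)\<^sup>2 - 16 * a\<^sup>2 * w\<^sup>2" "P \<noteq> 0"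
    using on_curve_prod(1)[OF c K] nz by (auto simp: P_def)
  \<comment> \<open>Cross terms agree on both sides. With \<open>16*a^2 + 16 = 4*K\<close> the rest
    becomes \<open>(w^2 - K)^2\<close> times the relation
    \<open>P^2 + 16*a^2*w^2 = (w^2 + K)^2\<close>.\<close>
  have "((w\<^sup>2 + K) * P + 4 * a * w * (w\<^sup>2 - K))\<^sup>2
      = (w ^ 4 - K\<^sup>2 + 2 * a * (2 * w * P))\<^sup>2 + 4 * (2 * w * P)\<^sup>2"
    "((w\<^sup>2 + K) * P - 4 * a * w * (w\<^sup>2 - K))\<^sup>2
      = (w ^ 4 - K\<^sup>2 - 2 * a * (2 * w * P))\<^sup>2 + 4 * (2 * w * P)\<^sup>2"
    using P(1) K by algebra+
  then show ?thesis
    using P(2) nz(1) unfolding on_curve_def P_def[symmetric]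
    by (simp add: power_divide divide_simps)
qed

text \<open>All three coordinates have 2-adic valuation \<open>-n\<close>.\<close>

definition level :: "real \<Rightarrow> nat \<Rightarrow> real \<times> real \<times> real \<Rightarrow> bool" where
  "level a n = (\<lambda>(w, X, Y). on_curve a w X Y \<and>
     2 ^ n * w \<in> unit2 \<and> 2 ^ n * X \<in> unit2 \<and> 2 ^ n * Y \<in> unit2)"

text \<open>After rescaling by \<open>2^n\<close>, which is even, the leading term of each numerator
  is a unit and all other terms are even. The factor 2 in the common denominator then lowers the
  valuation by exactly one.\<close>

lemma level_double:
  assumes a: "a \<in> int2" and n: "n \<ge> 1" and l: "level a n (w, X, Y)" and K: "K = 4 * a\<^sup>2 + 4"
  shows "\<exists>X' Y'. level a (Suc n) ((w ^ 4 - K\<^sup>2) / (2 * w * (X * Y)), X', Y')"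
proof -
  define t :: real where "t = 2 ^ n"
  define p q r where pqr: "p = t * w" "q = t * X" "r = t * Y"
  have c: "on_curve a w X Y" and u: "p \<in> unit2" "q \<in> unit2" "r \<in> unit2"
    using l unfolding level_def pqr t_def by auto
  have nz: "w \<noteq> 0" "X \<noteq> 0" "Y \<noteq> 0" "t \<noteq> 0" "p \<noteq> 0" "q \<noteq> 0" "r \<noteq> 0"
    using u[THEN unit2_nonzero] by (auto simp: pqr t_def)
  obtain s where s: "s \<in> int2" "t = 2 * s"
    using n int2_power[OF int2_numeral] unfolding t_def by (metis One_nat_def Suc_le_D power_Suc)
  have Ki: "K \<in> int2" unfolding K
    by (intro int2_add int2_mult int2_power int2_numeral a)
  note u' = u[THEN unit2_int2]
  have t: "t \<in> int2" unfolding s by (intro int2_mult int2_numeral s)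
  define D where "D = p * q * r"
  have D: "D \<in> unit2" unfolding D_def by (intro unit2_mult u)
  \<comment> \<open>Here \<open>2 * w * (X * Y) = 2 * D / t^3\<close> and
    \<open>2 ^ Suc n = 2 * t\<close>: the factors 2 cancel and \<open>t^4\<close> is left.\<close>
  have scale: "2 ^ Suc n * (N / (2 * w * (X * Y))) = M / D" if "M = t ^ 4 * N" for M N
  proof -
    have "D = t ^ 3 * (w * (X * Y))" unfolding D_def pqr by algebra
    then show ?thesis using nz that by (simp add: t_def[symmetric] power_numeral_reduce)
  qed
  let ?w = "(w ^ 4 - K\<^sup>2) / (2 * w * (X * Y))"
  let ?X = "((w\<^sup>2 + K) * (X * Y) + 4 * a * w * (w\<^sup>2 - K)) / (2 * w * (X * Y))"
  let ?Y = "((w\<^sup>2 + K) * (X * Y) - 4 * a * w * (w\<^sup>2 - K)) / (2 * w * (X * Y))"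
  have "2 ^ Suc n * ?w = (p ^ 4 + 2 * (0 - s * t ^ 3 * K\<^sup>2)) / D"
    by (rule scale) (use s(2) pqr in algebra)
  moreover have "p ^ 4 + 2 * (0 - s * t ^ 3 * K\<^sup>2) \<in> unit2"
    by (intro unit2_add_even unit2_power u int2_diff int2_mult int2_power s t Ki
        int2_of_int[of 0, simplified])
  ultimately have 1: "2 ^ Suc n * ?w \<in> unit2" using D unit2_divide by metis
  have "2 ^ Suc n * ?X = (p\<^sup>2 * q * r + 2 * (s * t * K * q * r + 2 * a * t * p * (p\<^sup>2 - t\<^sup>2 * K))) / D"
    by (rule scale) (use s(2) pqr in algebra)
  moreover have "p\<^sup>2 * q * r + 2 * (s * t * K * q * r + 2 * a * t * p * (p\<^sup>2 - t\<^sup>2 * K)) \<in> unit2"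
    by (intro unit2_add_even unit2_mult unit2_power u int2_add int2_diff int2_mult int2_power
        int2_numeral u' s t Ki a)
  ultimately have 2: "2 ^ Suc n * ?X \<in> unit2" using D unit2_divide by metis
  have "2 ^ Suc n * ?Y = (p\<^sup>2 * q * r + 2 * (s * t * K * q * r - 2 * a * t * p * (p\<^sup>2 - t\<^sup>2 * K))) / D"
    by (rule scale) (use s(2) pqr in algebra)
  moreover have "p\<^sup>2 * q * r + 2 * (s * t * K * q * r - 2 * a * t * p * (p\<^sup>2 - t\<^sup>2 * K)) \<in> unit2"
    by (intro unit2_add_even unit2_mult unit2_power u int2_add int2_diff int2_mult int2_power
        int2_numeral u' s t Ki a)
  ultimately have 3: "2 ^ Suc n * ?Y \<in> unit2" using D unit2_divide by metis
  show ?thesis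
    using 1 2 3 on_curve_double[OF c nz(1-3) K] unfolding level_def by blast
qed

section \<open>Contraction outside the rectangle\<close>

text \<open>If \<open>w^2\<close> is at least \<open>K + 8*a\<close>, dropping \<open>16*W\<close>
  from the denominator gives the bound. For smaller \<open>w^2\<close> the numerator factor
  \<open>q = w^2 - K\<close> is so small that the double would lie inside the rectangle.\<close>

lemma double_contracts:
  assumes a: "a \<ge> 4 / 5" and c: "on_curve a w X Y" and nz: "w \<noteq> 0" "X \<noteq> 0" "Y \<noteq> 0"
    and K: "K = 4 * a\<^sup>2 + 4" and w': "w' = (w ^ 4 - K\<^sup>2) / (2 * w * (X * Y))"
    and out: "4 * a\<^sup>2 \<le> w\<^sup>2" "4 * a\<^sup>2 \<le> w'\<^sup>2"
  shows "w'\<^sup>2 \<le> ((1 + K / (K + 8 * a)) / 2)\<^sup>2 * w\<^sup>2"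
proof -
  define W q where Wq: "W = w\<^sup>2" "q = W - K"
  have W: "W > 0" using nz unfolding Wq by simp
  have Kp: "K > 0" unfolding K by (simp add: add_nonneg_pos)
  have den: "(2 * w * (X * Y))\<^sup>2 = 4 * W * (q\<^sup>2 + 16 * W)"
    using on_curve_prod(2)[OF c K] by (simp add: power_mult_distrib Wq)
  have num: "w ^ 4 - K\<^sup>2 = q * (W + K)" unfolding Wq by algebra
  have pos: "4 * W * (q\<^sup>2 + 16 * W) > 0" using W by (simp add: add_nonneg_pos)
  have w'2: "w'\<^sup>2 = q\<^sup>2 * (W + K)\<^sup>2 / (4 * W * (q\<^sup>2 + 16 * W))"
    unfolding w' power_divide den num by (simp add: power_mult_distrib)
  have q8: "q \<ge> 8 * a"
  proof (rule ccontr)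
    assume "\<not> q \<ge> 8 * a"
    then have q: "q < 8 * a" "q \<ge> - 4" using out(1) unfolding Wq K by auto
    \<comment> \<open>For nonnegative \<open>q\<close>, both \<open>q < 8*a\<close> and
      \<open>q \<le> W\<close> hold. For negative \<open>q\<close>,
      \<open>q^2 \<le> 16 \<le> 32*a^3\<close>; this is where \<open>4/5\<close> enters, as
      \<open>32 * (4/5)^3 = 16.384\<close>.\<close>
    have q2: "q\<^sup>2 \<le> 8 * a * W"
    proof (cases "q \<ge> 0")
      case True
      have "q * q \<le> (8 * a) * W" using True q(1) Kp a by (intro mult_mono) (auto simp: Wq)
      then show ?thesis by (simp add: power2_eq_square)
    next
      case False
      have "(- q) * (- q) \<le> 4 * 4" using False q by (intro mult_mono) auto
      moreover have "8 * a * W \<ge> 8 * a * (4 * a\<^sup>2)"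
        using out(1) a unfolding Wq by (intro mult_left_mono) auto
      moreover have "8 * a * (4 * a\<^sup>2) = 32 * a ^ 3" by algebra
      moreover have "a ^ 3 \<ge> (4 / 5) ^ 3" using a by (intro power_mono) auto
      then have "a ^ 3 \<ge> 64 / 125" by (simp add: power3_eq_cube)
      moreover have "(- q) * (- q) = q\<^sup>2" by algebra
      ultimately show ?thesis by linarith
    qed
    have "q\<^sup>2 * (W + K)\<^sup>2 = q\<^sup>2 * q\<^sup>2 + q\<^sup>2 * (4 * W * K)" unfolding Wq by algebra
    also have "\<dots> = q\<^sup>2 * q\<^sup>2 + 16 * a\<^sup>2 * W * q\<^sup>2 + 16 * W * q\<^sup>2" unfolding K by algebra
    also have "q\<^sup>2 * q\<^sup>2 \<le> (8 * a * W) * (8 * a * W)" using q2 W a by (intro mult_mono) auto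
    also have "16 * W * q\<^sup>2 \<le> 16 * W * (8 * a * W)" using q2 W by (intro mult_left_mono) auto
    finally have "q\<^sup>2 * (W + K)\<^sup>2 \<le> 64 * a\<^sup>2 * W\<^sup>2 + 128 * a * W\<^sup>2 + 16 * a\<^sup>2 * W * q\<^sup>2"
      by (simp add: power2_eq_square algebra_simps)
    \<comment> \<open>True for \<open>a > 2/3\<close>. The bound becomes
      \<open>256*a^2*W^2 + 16*a^2*W*q^2\<close>, which is \<open>4*a^2\<close> times the denominator
      of \<open>w'^2\<close>.\<close>
    moreover have "128 * a * W\<^sup>2 < 192 * a\<^sup>2 * W\<^sup>2"
      using a W by (simp add: power2_eq_square)
    ultimately have "q\<^sup>2 * (W + K)\<^sup>2 < (4 * a\<^sup>2) * (4 * W * (q\<^sup>2 + 16 * W))"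
      by (simp add: power2_eq_square algebra_simps)
    then have "w'\<^sup>2 < 4 * a\<^sup>2" unfolding w'2 using pos by (simp add: pos_divide_less_eq)
    then show False using out(2) by simp
  qed
  have "w'\<^sup>2 \<le> (W + K)\<^sup>2 / (4 * W)"
  proof -
    have "q\<^sup>2 * (W + K)\<^sup>2 \<le> (q\<^sup>2 + 16 * W) * (W + K)\<^sup>2" using W by (intro mult_right_mono) auto
    then have "w'\<^sup>2 \<le> (q\<^sup>2 + 16 * W) * (W + K)\<^sup>2 / (4 * W * (q\<^sup>2 + 16 * W))"
      unfolding w'2 using pos by (intro divide_right_mono) auto
    also have "\<dots> = (W + K)\<^sup>2 / (4 * W)" using pos by auto
    finally show ?thesis .
  qed
  also have "\<dots> = ((1 + K / W) / 2)\<^sup>2 * W"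
    using W by (simp add: power2_eq_square field_simps)
  also have "\<dots> \<le> ((1 + K / (K + 8 * a)) / 2)\<^sup>2 * W"
    using W Kp a q8 unfolding Wq(2)
    by (intro mult_right_mono power_mono divide_right_mono add_left_mono divide_left_mono) auto
  finally show ?thesis unfolding Wq .
qed

section \<open>From orbits to infinitely many points\<close>

text \<open>By symmetry about the midline only two distances occur, \<open>\<bar>X\<bar>/4\<close>
  and \<open>\<bar>Y\<bar>/4\<close>.\<close>

lemma midline_good_point:
  assumes "a \<in> \<rat>" "w \<in> \<rat>" "X \<in> \<rat>" "Y \<in> \<rat>" "on_curve a w X Y" "\<bar>w\<bar> < 2 * a"
  shows "((w + 2 * a) / 4, 1 / 2) \<in> good_points a"
proof -
  define x where "x = (w + 2 * a) / 4"
  have "x - a = (w - 2 * a) / 4" unfolding x_def by simp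
  then have eqs: "x\<^sup>2 + (1 / 2)\<^sup>2 = (X / 4)\<^sup>2" "(x - a)\<^sup>2 + (1 / 2)\<^sup>2 = (Y / 4)\<^sup>2"
    using assms(5) unfolding on_curve_def x_def
    by (simp_all only: power_divide) (simp_all add: add_divide_distrib)
  have half: "(1 / 2 - 1 :: real)\<^sup>2 = (1 / 2)\<^sup>2" by (simp add: power2_eq_square)
  have "\<bar>X / 4\<bar> \<in> \<rat>" "\<bar>Y / 4\<bar> \<in> \<rat>" using assms(3,4) by auto
  then have "pdist (x, 1 / 2) (0, 0) \<in> \<rat>" "pdist (x, 1 / 2) (0, 1) \<in> \<rat>"
    "pdist (x, 1 / 2) (a, 0) \<in> \<rat>" "pdist (x, 1 / 2) (a, 1) \<in> \<rat>"
    unfolding pdist_def fst_conv snd_conv diff_0_right half eqs real_sqrt_abs by blast+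
  moreover have "x \<in> \<rat>" using assms(1,2) by (auto simp: x_def)
  moreover have "0 < x" "x < a" using assms(6) by (auto simp: x_def)
  ultimately show ?thesis unfolding good_points_def x_def[symmetric] by simp
qed

text \<open>If only finitely many orbit points were interior, then from some index on
  \<open>w^2\<close> would decay geometrically while staying at least \<open>4*a^2\<close>.\<close>

lemma infinite_good_points:
  assumes a: "a \<in> int2" "a \<ge> 4 / 5" and n: "n \<ge> 1" and l: "level a n P"
  shows "infinite (good_points a)"
proof
  assume fin: "finite (good_points a)"
  define K where "K = 4 * a\<^sup>2 + 4"
  define d where "d = (\<lambda>(w, X, Y). (w ^ 4 - K\<^sup>2) / (2 * w * (X * Y)))"
  \<comment> \<open>Dependent choice builds the orbit: the level lemma gives the new
    \<open>X\<close> and \<open>Y\<close> only existentially, and just the recursion for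
    \<open>w\<close> is needed later.\<close>
  have "\<exists>f. \<forall>k. level a (n + k) (f k) \<and> fst (f (Suc k)) = d (f k)"
  proof (rule dependent_nat_choice)
    show "\<exists>x. level a (n + 0) x" using l by (intro exI[of _ P]) simp
    show "\<exists>y. level a (n + Suc k) y \<and> fst y = d x" if lx: "level a (n + k) x" for x k
    proof -
      obtain w X Y where x: "x = (w, X, Y)" by (cases x)
      obtain X' Y' where "level a (Suc (n + k)) (d x, X', Y')"
        using level_double[OF a(1) _ lx[unfolded x] K_def] n unfolding d_def x by auto
      then show ?thesis by (intro exI[of _ "(d x, X', Y')"]) simp
    qed
  qed
  then obtain f where f: "\<And>k. level a (n + k) (f k)" "\<And>k. fst (f (Suc k)) = d (f k)" by blast
  define w X Y where wXY: "w k = fst (f k)" "X k = fst (snd (f k))" "Y k = snd (snd (f k))" for k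
  have c: "on_curve a (w k) (X k) (Y k)"
    and u: "2 ^ (n + k) * w k \<in> unit2" "2 ^ (n + k) * X k \<in> unit2" "2 ^ (n + k) * Y k \<in> unit2" for k
    using f(1)[of k] unfolding level_def wXY by (auto simp: split_beta)
  have step: "w (Suc k) = (w k ^ 4 - K\<^sup>2) / (2 * w k * (X k * Y k))" for k
    using f(2)[of k] unfolding d_def wXY by (auto simp: split_beta)
  have nz: "w k \<noteq> 0" "X k \<noteq> 0" "Y k \<noteq> 0" for k
    using u[of k, THEN unit2_nonzero] by auto
  have rat: "x \<in> \<rat>" if "2 ^ m * x \<in> unit2" for x m
  proof -
    have "2 ^ m * x / 2 ^ m \<in> \<rat>" using int2_Rats[OF unit2_int2[OF that]] by (intro Rats_divide) auto
    then show ?thesis by simp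
  qed
  \<comment> \<open>\<open>w k\<close> has valuation \<open>-(n + k)\<close>, so no value
    repeats.\<close>
  have inj: "inj w"
  proof (rule injI)
    fix i j assume "w i = w j"
    then show "i = j" using two_adic_scale_unique[of "n + i" "w i" "n + j"] u(1)[of i] u(1)[of j] by simp
  qed
  define I where "I = {k. \<bar>w k\<bar> < 2 * a}"
  have "(\<lambda>k. ((w k + 2 * a) / 4, 1 / 2)) ` I \<subseteq> good_points a"
    using midline_good_point[OF int2_Rats[OF a(1)] rat[OF u(1)] rat[OF u(2)] rat[OF u(3)] c]
    unfolding I_def by auto
  moreover have "inj_on (\<lambda>k. ((w k + 2 * a) / 4, 1 / 2 :: real)) I"
    using inj unfolding inj_def inj_on_def by auto
  ultimately have "finite I" using fin by (meson finite_imageD finite_subset)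
  then obtain N where N: "\<And>k. k \<in> I \<Longrightarrow> k < N"
    by (meson finite_nat_set_iff_bounded)
  have out: "4 * a\<^sup>2 \<le> (w k)\<^sup>2" if "k \<ge> N" for k
  proof -
    have "2 * a \<le> \<bar>w k\<bar>" using N[of k] that unfolding I_def by force
    then have "(2 * a)\<^sup>2 \<le> \<bar>w k\<bar>\<^sup>2" using a(2) by (intro power_mono) auto
    then show ?thesis by (simp add: power_mult_distrib)
  qed
  define r where "r = ((1 + K / (K + 8 * a)) / 2)\<^sup>2"
  have Kp: "K > 0" unfolding K_def by (simp add: add_nonneg_pos)
  have "r < 1\<^sup>2" unfolding r_def
    using Kp a(2) by (intro power_strict_mono) (auto simp: add_pos_pos)
  then have r: "r \<ge> 0" "r < 1" unfolding r_def by auto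
  have geom: "(w (N + j))\<^sup>2 \<le> r ^ j * (w N)\<^sup>2" for j
  proof (induction j)
    case (Suc j)
    have "(w (Suc (N + j)))\<^sup>2 \<le> r * (w (N + j))\<^sup>2"
      unfolding r_def
      by (rule double_contracts[OF a(2) c nz K_def step out out]) auto
    also have "\<dots> \<le> r * (r ^ j * (w N)\<^sup>2)" using Suc r by (intro mult_left_mono) auto
    finally show ?case by simp
  qed simp
  have "(\<lambda>j. r ^ j * (w N)\<^sup>2) \<longlonglongrightarrow> 0 * (w N)\<^sup>2"
    using r by (intro tendsto_mult LIMSEQ_realpow_zero tendsto_const) auto
  moreover have "4 * a\<^sup>2 \<le> r ^ j * (w N)\<^sup>2" for j
    using geom[of j] out[of "N + j"] by linarith
  ultimately have "4 * a\<^sup>2 \<le> 0" by (intro LIMSEQ_le_const) auto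
  then show False using a(2) by simp
qed

section \<open>A family of sides with a starting point\<close>

lemma good_side_family:
  assumes r: "r \<in> int2" and a: "a = r * (16 * r - 17) / (16 * r - 1)" "a \<ge> 4 / 5"
  shows "a \<in> good_sides"
proof -
  define q where "q = 16 * r - 1"
  have "q = of_int (-1) / of_int 1 + 2 * (8 * r)" unfolding q_def by simp
  also have "\<dots> \<in> unit2" by (intro unit2_add_even unit2I int2_mult int2_numeral r) auto
  finally have q: "q \<in> unit2" .
  have "1 / q \<in> int2" using unit2_divide[OF unit2_one q] unit2_int2 by blast
  then have "r * (16 * r - 17) * (1 / q) \<in> int2"
    by (intro int2_mult int2_diff int2_numeral r)
  then have ai: "a \<in> int2" unfolding a q_def by simp
  have q0: "q \<noteq> 0" using unit2_nonzero q by blast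
  have "a * q = r * (16 * r - 17)" using q0 unfolding a q_def by simp
  then have aq: "16 * a * q = (q - 16) * (q + 1)" unfolding q_def by algebra
  \<comment> \<open>With t = 1/4 and s = q/4, put w + 2a = t - 1/t and 2a - w = s - 1/s, so that X = t + 1/t
    and Y = s + 1/s; q \<equiv> -1 mod 16 makes a integral at 2.\<close>
  have "on_curve a (- (15 / 4) - 2 * a) (17 / 4) (q / 4 + 4 / q)"
  proof -
    have "4 * a = - (15 / 4) + q / 4 - 4 / q" using aq q0 by (simp add: field_simps)
    then have *: "- (15 / 4) - 2 * a - 2 * a = 4 / q - q / 4" by simp
    show ?thesis unfolding on_curve_def *
      using q0 by (simp add: power2_eq_square field_simps)
  qed
  \<comment> \<open>The starting point has level 2: four times its coordinates are
    \<open>-15 - 8*a\<close>, \<open>17\<close> and \<open>q + 16/q\<close>, each a unit.\<close>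
  moreover have "2 ^ 2 * (- (15 / 4) - 2 * a) \<in> unit2"
  proof -
    have "2 ^ 2 * (- (15 / 4) - 2 * a) = of_int (- 15) / of_int 1 + 2 * (of_int (- 4) * a)" by simp
    also have "\<dots> \<in> unit2" by (intro unit2_add_even unit2I int2_mult int2_of_int ai) auto
    finally show ?thesis .
  qed
  moreover have "2 ^ 2 * (17 / 4) \<in> unit2" using unit2I[of 17 1] by simp
  moreover have "2 ^ 2 * (q / 4 + 4 / q) \<in> unit2"
  proof -
    have "2 ^ 2 * (q / 4 + 4 / q) = q + 2 * (8 * (1 / q))" by simp
    also have "\<dots> \<in> unit2" by (intro unit2_add_even int2_mult int2_numeral q \<open>1 / q \<in> int2\<close>)
    finally show ?thesis .
  qed
  ultimately have "level a 2 (- (15 / 4) - 2 * a, 17 / 4, q / 4 + 4 / q)"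
    unfolding level_def by simp
  then have "infinite (good_points a)" using infinite_good_points[OF ai a(2), of 2] by simp
  then show ?thesis using int2_Rats[OF ai] a(2) unfolding good_sides_def by auto
qed

section \<open>Density\<close>

text \<open>Truncate base-3 expansions: powers of 3 are odd.\<close>

lemma int2_approx: "\<exists>f. (\<forall>n. f n \<in> int2) \<and> f \<longlonglongrightarrow> x"
proof (intro exI conjI allI)
  let ?f = "\<lambda>n. of_int \<lfloor>x * 3 ^ n\<rfloor> / of_int (3 ^ n)"
  show "?f n \<in> int2" for n by (rule int2I) simp
  have "(\<lambda>n. x - (1 / 3) ^ n) \<longlonglongrightarrow> x - 0"
    by (intro tendsto_diff tendsto_const LIMSEQ_realpow_zero) auto
  then have lim: "(\<lambda>n. x - (1 / 3) ^ n) \<longlonglongrightarrow> x" by simp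
  have lower: "x - (1 / 3) ^ n \<le> ?f n" for n
  proof -
    have "x * 3 ^ n - 1 \<le> of_int \<lfloor>x * 3 ^ n\<rfloor>" by linarith
    then have "(x * 3 ^ n - 1) / 3 ^ n \<le> of_int \<lfloor>x * 3 ^ n\<rfloor> / 3 ^ n"
      by (rule divide_right_mono) simp
    then show ?thesis by (simp add: diff_divide_distrib power_divide)
  qed
  have upper: "?f n \<le> x" for n by (simp add: divide_le_eq)
  show "?f \<longlonglongrightarrow> x"
    by (rule tendsto_sandwich[OF _ _ lim tendsto_const]) (use lower upper in auto)
qed

lemma good_sides_dense_ge_1:
  assumes "c \<ge> 1" shows "c \<in> closure good_sides"
proof -
  define g :: "real \<Rightarrow> real" where "g r = r * (16 * r - 17) / (16 * r - 1)" for r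
  \<comment> \<open>\<open>\<rho>\<close> is the larger root of
    \<open>16*r^2 - (17 + 16*c)*r + c = 0\<close>, the equation \<open>g r = c\<close> cleared of
    its denominator. It exceeds 1, so it avoids the pole \<open>1/16\<close>.\<close>
  define s where "s = sqrt ((17 + 16 * c)\<^sup>2 - 64 * c)"
  define \<rho> where "\<rho> = (17 + 16 * c + s) / 32"
  have "(17 + 16 * c)\<^sup>2 - 64 * c \<ge> 0" using assms by (simp add: power2_eq_square algebra_simps)
  then have s: "s\<^sup>2 = (17 + 16 * c)\<^sup>2 - 64 * c" "s \<ge> 0" unfolding s_def by simp_all
  have \<rho>: "16 * \<rho> - 1 \<noteq> 0" using s(2) assms unfolding \<rho>_def by simp
  have "32 * \<rho> = 17 + 16 * c + s" unfolding \<rho>_def by simp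
  then have "(32 * \<rho> - (17 + 16 * c))\<^sup>2 = (17 + 16 * c)\<^sup>2 - 64 * c" using s(1) by simp
  then have "\<rho> * (16 * \<rho> - 17) = c * (16 * \<rho> - 1)" by (simp add: power2_eq_square algebra_simps)
  then have gc: "g \<rho> = c" using \<rho> unfolding g_def by simp
  obtain f where f: "\<And>n. f n \<in> int2" "f \<longlonglongrightarrow> \<rho>" using int2_approx by blast
  have "(\<lambda>n. g (f n)) \<longlonglongrightarrow> g \<rho>"
    unfolding g_def using \<rho> f(2) by (intro tendsto_intros) auto
  then have lim: "(\<lambda>n. g (f n)) \<longlonglongrightarrow> c" unfolding gc .
  have "\<forall>\<^sub>F n in sequentially. g (f n) > 4 / 5"
    using order_tendstoD(1)[OF lim, of "4 / 5"] assms by simp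
  then have "\<forall>\<^sub>F n in sequentially. g (f n) \<in> closure good_sides"
    by eventually_elim
      (use good_side_family[OF f(1)] closure_subset[of good_sides] in \<open>fastforce simp: g_def\<close>)
  then show ?thesis
    using Lim_in_closed_set[OF closed_closure _ sequentially_bot lim] by blast
qed

text \<open>Reflection in the diagonal followed by scaling by \<open>1/a\<close> carries one
  rectangle to the other, permuting the roles of the vertices and dividing all distances by the
  rational \<open>a\<close>.\<close>

lemma good_sides_inverse:
  assumes "a \<in> good_sides" shows "1 / a \<in> good_sides"
proof -
  have a: "a \<in> \<rat>" "a > 0" "infinite (good_points a)" using assms unfolding good_sides_def by auto
  have scale: "sqrt ((x / a)\<^sup>2 + (y / a)\<^sup>2) = sqrt (x\<^sup>2 + y\<^sup>2) / a" for x y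
    using a(2) by (simp add: power_divide add_divide_distrib[symmetric] real_sqrt_divide)
  have d: "pdist (y / a, x / a) (v / a, u / a) = pdist (x, y) (u, v) / a" for x y u v
    unfolding pdist_def by (simp add: diff_divide_distrib[symmetric] scale add.commute)
  have "(\<lambda>(x, y). (y / a, x / a)) ` good_points a \<subseteq> good_points (1 / a)"
  proof clarify
    fix x y assume h: "(x, y) \<in> good_points a"
    then have "pdist (x, y) (0, 0) / a \<in> \<rat>" "pdist (x, y) (0, 1) / a \<in> \<rat>"
      "pdist (x, y) (a, 0) / a \<in> \<rat>" "pdist (x, y) (a, 1) / a \<in> \<rat>"
      using a(1) unfolding good_points_def by auto
    then show "(y / a, x / a) \<in> good_points (1 / a)"
      using h a unfolding good_points_def d[symmetric] by (simp add: divide_strict_right_mono)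
  qed
  moreover have "inj_on (\<lambda>(x, y). (y / a, x / a)) (good_points a)"
    using a(2) by (auto simp: inj_on_def)
  ultimately have "infinite (good_points (1 / a))"
    using a(3) by (meson finite_imageD finite_subset)
  then show ?thesis using a unfolding good_sides_def by simp
qed

theorem theorem2p3:
  shows "{0<..} \<subseteq> closure good_sides"
proof
  fix c :: real assume "c \<in> {0<..}"
  then have c: "c > 0" by simp
  show "c \<in> closure good_sides"
  proof (cases "c \<ge> 1")
    case False
    \<comment> \<open>Approximate \<open>1/c > 1\<close> by good sides and invert them; inversion is
      continuous away from 0.\<close>
    have "1 / c \<in> closure good_sides" using c False by (intro good_sides_dense_ge_1) simp
    then obtain f where f: "\<And>n. f n \<in> good_sides" "f \<longlonglongrightarrow> 1 / c"
      unfolding closure_sequential by blast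
    have "(\<lambda>n. 1 / f n) \<longlonglongrightarrow> 1 / (1 / c)" using c f(2) by (intro tendsto_intros) auto
    then have "(\<lambda>n. 1 / f n) \<longlonglongrightarrow> c" by simp
    moreover have "1 / f n \<in> good_sides" for n by (rule good_sides_inverse[OF f(1)])
    ultimately show ?thesis unfolding closure_sequential by (intro exI[of _ "\<lambda>n. 1 / f n"]) simp
  qed (rule good_sides_dense_ge_1)
qed

end
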